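(* Let $E$ and $F$ be two Riesz spaces, and let $T : E^{+} \to F^{+}$ be a monotone sublinear mapping. Then the mapping $S : E \to F$ defined by $S(x) = T(x^{+})$, $x \in E$, is a monotone sublinear extension of $T$ to $E$ (that is, $S$ is monotone and sublinear on $E$, and $S(x)=T(x)$ for all $x \in E^{+}$).
   Context: A Riesz space (vector lattice) is a real ordered vector space in which every pair of elements has a supremum $x \vee y$ and an infimum $x\wedge y$. $E^{+}=\{x\in E: x\ge 0\}$ is the positive cone and $x^{+}=x\vee 0$. Let $C$ be an ordered vector space or the positive cone of one, and likewise $D$. A mapping $T:C\to D$ is called sublinear if $T(x+y)\le T(x)+T(y)$ and $T(\lambda x)=\lambda T(x)$ for all $x,y\in C$ and all real $\lambda\ge 0$. It is called monotone if $x\ge y$ implies $T(x)\ge T(y)$. *)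

theory Defs
  imports Complex_Main "HOL-Library.Lattice_Algebras" "HOL-Library.FuncSet"
begin

class riesz_space = ordered_real_vector + lattice

text \<open>The positive cone of a Riesz space is \<open>{0..}\<close>. The following instance makes the
  library's positive part available: \<open>pprt x = sup x 0\<close>.\<close>

subclass (in riesz_space) lattice_ab_group_add ..

text \<open>A map is represented by a total function, of which only the restriction to its domain
  \<open>C\<close> (\<open>UNIV\<close> or \<open>{0..}\<close>) matters.\<close>

definition sublinear_on :: "'a::ordered_real_vector set \<Rightarrow> ('a \<Rightarrow> 'b::ordered_real_vector) \<Rightarrow> bool"
  where "sublinear_on C T \<longleftrightarrow>
    (\<forall>x\<in>C. \<forall>y\<in>C. T (x + y) \<le> T x + T y) \<and>
    (\<forall>x\<in>C. \<forall>r::real. r \<ge> 0 \<longrightarrow> T (r *\<^sub>R x) = r *\<^sub>R T x)"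

end

theory Submission imports Defs begin

text \<open>
  The positive part \<open>x \<mapsto> x\<^sup>+\<close> is itself a monotone sublinear map of a Riesz space onto its
  positive cone, and it fixes the cone pointwise. Monotone sublinear maps compose:
  monotonicity of the outer map is what turns \<open>(x + y)\<^sup>+ \<le> x\<^sup>+ + y\<^sup>+\<close> into
  \<open>T ((x + y)\<^sup>+) \<le> T (x\<^sup>+ + y\<^sup>+)\<close>, after which subadditivity of \<open>T\<close> on the cone applies. So
  \<open>x \<mapsto> T (x\<^sup>+)\<close> is monotone and sublinear, and it extends \<open>T\<close>.
\<close>

lemma pprt_add_le:
  fixes x y :: "'a::lattice_ab_group_add"
  shows "pprt (x + y) \<le> pprt x + pprt y"
  unfolding pprt_def by (intro sup_least add_mono add_nonneg_nonneg) simp_all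

text \<open>For \<open>r > 0\<close>, scaling by \<open>r\<close> is an order automorphism that fixes \<open>0\<close>, so it commutes with
  the supremum defining the positive part; both inequalities come from scaling by \<open>r\<close> or by
  its inverse. For \<open>r = 0\<close> both sides vanish.\<close>

lemma pprt_scaleR:
  fixes x :: "'a::riesz_space"
  assumes "0 \<le> r"
  shows "pprt (r *\<^sub>R x) = r *\<^sub>R pprt x"
proof (cases "r = 0")
  case False
  with assms have r: "0 < r" by simp
  have le: "pprt (s *\<^sub>R y) \<le> s *\<^sub>R pprt y" if "0 < s" for s and y :: 'a
    unfolding pprt_def using that
    by (intro sup_least scaleR_left_mono scaleR_nonneg_nonneg) simp_all
  show ?thesis
  proof (rule antisym)
    have "pprt x \<le> inverse r *\<^sub>R pprt (r *\<^sub>R x)"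
      using le[of "inverse r" "r *\<^sub>R x"] r by simp
    then have "r *\<^sub>R pprt x \<le> r *\<^sub>R (inverse r *\<^sub>R pprt (r *\<^sub>R x))"
      using assms by (rule scaleR_left_mono)
    then show "r *\<^sub>R pprt x \<le> pprt (r *\<^sub>R x)"
      using r by simp
  qed (rule le[OF r])
qed simp

theorem theorem3p1:
  fixes T :: "'e::riesz_space \<Rightarrow> 'f::riesz_space" and S :: "'e \<Rightarrow> 'f"
  assumes "T \<in> {0..} \<rightarrow> {0..}"
    and "mono_on {0..} T"
    and "sublinear_on {0..} T"
    and "\<And>x. S x = T (pprt x)"
  shows "mono S \<and> sublinear_on UNIV S \<and> (\<forall>x\<in>{0..}. S x = T x)"
proof (intro conjI ballI)
  have T_mono: "T x \<le> T y" if "0 \<le> x" "x \<le> y" for x y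
    using that by (intro mono_onD[OF assms(2)]) auto
  have T_add: "T (x + y) \<le> T x + T y" if "0 \<le> x" "0 \<le> y" for x y
    using assms(3) that unfolding sublinear_on_def by simp
  have T_scale: "T (r *\<^sub>R x) = r *\<^sub>R T x" if "0 \<le> x" "0 \<le> r" for x and r :: real
    using assms(3) that unfolding sublinear_on_def by simp
  show "mono S"
    by (intro monoI) (simp add: assms(4) T_mono pprt_mono)
  have "S (x + y) \<le> S x + S y" for x y
  proof -
    have "T (pprt (x + y)) \<le> T (pprt x + pprt y)"
      by (intro T_mono pprt_add_le zero_le_pprt)
    also have "\<dots> \<le> T (pprt x) + T (pprt y)"
      by (intro T_add zero_le_pprt)
    finally show ?thesis by (simp add: assms(4))
  qed
  moreover have "S (r *\<^sub>R x) = r *\<^sub>R S x" if "0 \<le> r" for r :: real and x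
    using that by (simp add: assms(4) pprt_scaleR T_scale)
  ultimately show "sublinear_on UNIV S"
    unfolding sublinear_on_def by blast
  show "S x = T x" if "x \<in> {0..}" for x
    using that by (simp add: assms(4) pprt_eq_id)
qed

end
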